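(* Let $\lambda\in(-\pi/2,\pi/2)$, and put $A_n=|1+ne^{-i\lambda}|+|1-ne^{-i\lambda}|$ for $n\ge 1$ and $B=|1+e^{-i\lambda}|-|1-e^{-i\lambda}|$. Let $f=h+\overline{g}\in\mathcal{H}$ with $h(z)=z+\sum_{n=2}^\infty a_nz^n$ and $g(z)=\sum_{n=1}^\infty b_nz^n$ satisfy $$\sum_{n=2}^\infty\frac{A_n}{B}|a_n|+\sum_{n=1}^\infty\frac{A_n}{B}|b_n|\leq 1.$$ Then for every $z\in\mathbb{D}$ with $|z|=r$, $$\left(1-\frac{B}{A_1}\right)r\leq |f(z)|\leq\left(1+\frac{B}{A_1}\right)r,$$ these inequalities are sharp (neither constant $1-\frac{B}{A_1}$ nor $1+\frac{B}{A_1}$ can be improved over the class of all such $f$), and $$\left\{w\in\mathbb{C}:|w|<1-\frac{B}{A_1}\right\}\subset f(\mathbb{D}).$$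
   Context: $\mathbb{D}=\{z\in\mathbb{C}:|z|<1\}$. $\mathcal{H}$ is the class of harmonic functions $f=h+\overline{g}$ in $\mathbb{D}$, with $h,g$ analytic in $\mathbb{D}$ of the form $h(z)=z+\sum_{n=2}^\infty a_nz^n$, $g(z)=\sum_{n=1}^\infty b_nz^n$ (complex coefficients), that are sense-preserving, i.e. the Jacobian $J_f=|h'|^2-|g'|^2$ is positive on $\mathbb{D}$. *)

theory Defs
  imports "HOL-Complex_Analysis.Complex_Analysis"
begin

abbreviation unit_disc :: "complex set" where
  "unit_disc \<equiv> ball 0 1"

definition jacobian :: "(complex \<Rightarrow> complex) \<Rightarrow> (complex \<Rightarrow> complex) \<Rightarrow> complex \<Rightarrow> real" where
  "jacobian h g z = (cmod (deriv h z))\<^sup>2 - (cmod (deriv g z))\<^sup>2"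

text \<open>
  Membership of \<open>f\<close> in the class of normalised sense-preserving harmonic functions on the unit
  disc, together with its canonical decomposition and coefficients: \<open>f = h + cnj g\<close> on the disc,
  where \<open>h z = z + (\<Sum>n\<ge>2. a n * z ^ n)\<close> and \<open>g z = (\<Sum>n\<ge>1. b n * z ^ n)\<close>.
  The values \<open>a 0\<close>, \<open>a 1\<close> and \<open>b 0\<close> are never used, and \<open>f\<close>, \<open>h\<close>, \<open>g\<close> are unconstrained
  outside the disc. Harmonicity of \<open>f\<close> is implied by the decomposition.
\<close>

definition harmonic_class ::
  "(complex \<Rightarrow> complex) \<Rightarrow> (complex \<Rightarrow> complex) \<Rightarrow> (complex \<Rightarrow> complex) \<Rightarrow>
    (nat \<Rightarrow> complex) \<Rightarrow> (nat \<Rightarrow> complex) \<Rightarrow> bool" where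
  "harmonic_class f h g a b \<longleftrightarrow>
     h holomorphic_on unit_disc \<and> g holomorphic_on unit_disc \<and>
     (\<forall>z\<in>unit_disc. (\<lambda>n. a (n + 2) * z ^ (n + 2)) sums (h z - z)) \<and>
     (\<forall>z\<in>unit_disc. (\<lambda>n. b (n + 1) * z ^ (n + 1)) sums g z) \<and>
     (\<forall>z\<in>unit_disc. f z = h z + cnj (g z)) \<and>
     (\<forall>z\<in>unit_disc. jacobian h g z > 0)"

definition A_coef :: "real \<Rightarrow> nat \<Rightarrow> real" where
  "A_coef l n = cmod (1 + of_nat n * exp (- \<i> * of_real l)) + cmod (1 - of_nat n * exp (- \<i> * of_real l))"

definition B_coef :: "real \<Rightarrow> real" where
  "B_coef l = cmod (1 + exp (- \<i> * of_real l)) - cmod (1 - exp (- \<i> * of_real l))"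

text \<open>
  The sums run over \<open>n \<ge> 2\<close> and \<open>n \<ge> 1\<close> respectively; convergence is required explicitly because
  \<open>suminf\<close> of a divergent series is unspecified.
\<close>

definition coef_condition :: "real \<Rightarrow> (nat \<Rightarrow> complex) \<Rightarrow> (nat \<Rightarrow> complex) \<Rightarrow> bool" where
  "coef_condition l a b \<longleftrightarrow>
     summable (\<lambda>n. A_coef l (n + 2) / B_coef l * cmod (a (n + 2))) \<and>
     summable (\<lambda>n. A_coef l (n + 1) / B_coef l * cmod (b (n + 1))) \<and>
     (\<Sum>n. A_coef l (n + 2) / B_coef l * cmod (a (n + 2))) +
     (\<Sum>n. A_coef l (n + 1) / B_coef l * cmod (b (n + 1))) \<le> 1"

end

theory Submission
  imports Defs
begin

text \<open>
  Since \<open>A_n \<ge> A_1\<close>, the coefficient condition gives \<open>\<Sum>\<bar>a_n\<bar> + \<Sum>\<bar>b_n\<bar> \<le> k\<close> with \<open>k = B / A_1\<close>, hence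
  \<open>\<bar>f z - z\<bar> \<le> k \<bar>z\<bar>\<close>, which yields both growth estimates. For the covering statement, \<open>f z = w\<close> says
  that \<open>z\<close> is a fixed point of \<open>z \<mapsto> w - (f z - z)\<close>; this continuous map sends the closed disc of radius
  \<open>\<bar>w\<bar> / (1 - k)\<close> into itself, so Brouwer's theorem applies. Sharpness is witnessed by
  \<open>z + t cnj z\<close> with \<open>t < k\<close> tending to \<open>k\<close>; the value \<open>t = k\<close> itself is not allowed when \<open>l = 0\<close>,
  because then \<open>k = 1\<close> and the Jacobian vanishes.
\<close>

text \<open>For \<open>t \<ge> 1\<close> the points \<open>v + u\<close> and \<open>v - u\<close>
  lie on the segment joining \<open>v + t *\<^sub>R u\<close> and \<open>v - t *\<^sub>R u\<close>,
  symmetrically about its midpoint \<open>v\<close>. Convexity of the norm bounds each of them with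
  mirrored weights, and adding the two bounds makes the weights sum to 1.\<close>

lemma norm_add_norm_diff_mono:
  fixes u v :: "'a::real_normed_vector" and t :: real
  assumes "t \<ge> 1"
  shows "norm (v + u) + norm (v - u) \<le> norm (v + t *\<^sub>R u) + norm (v - t *\<^sub>R u)"
proof -
  \<comment> \<open>These weights solve \<open>p + q = 1\<close> and
    \<open>(p - q) * t = 1\<close>.\<close>
  define p q where "p = (t + 1) / (2 * t)" and "q = (t - 1) / (2 * t)"
  have pq: "p \<ge> 0" "q \<ge> 0" "p + q = 1" "(p - q) * t = 1"
    using assms by (auto simp: p_def q_def field_simps)
  have "v + u = (p + q) *\<^sub>R v + ((p - q) * t) *\<^sub>R u" using pq by simp
  also have "\<dots> = p *\<^sub>R (v + t *\<^sub>R u) + q *\<^sub>R (v - t *\<^sub>R u)"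
    by (simp add: algebra_simps)
  finally have 1: "norm (v + u) \<le> p * norm (v + t *\<^sub>R u) + q * norm (v - t *\<^sub>R u)"
    using norm_triangle_ineq[of "p *\<^sub>R (v + t *\<^sub>R u)" "q *\<^sub>R (v - t *\<^sub>R u)"] pq by simp
  have "v - u = (p + q) *\<^sub>R v - ((p - q) * t) *\<^sub>R u" using pq by simp
  also have "\<dots> = q *\<^sub>R (v + t *\<^sub>R u) + p *\<^sub>R (v - t *\<^sub>R u)"
    by (simp add: algebra_simps)
  finally have 2: "norm (v - u) \<le> q * norm (v + t *\<^sub>R u) + p * norm (v - t *\<^sub>R u)"
    using norm_triangle_ineq[of "q *\<^sub>R (v + t *\<^sub>R u)" "p *\<^sub>R (v - t *\<^sub>R u)"] pq by simp
  have "norm (v + u) + norm (v - u) \<le> (p + q) * norm (v + t *\<^sub>R u) + (p + q) * norm (v - t *\<^sub>R u)"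
    using 1 2 by (simp only: distrib_right)
  then show ?thesis using pq by simp
qed

lemma A_coef_mono: "n \<ge> 1 \<Longrightarrow> A_coef l 1 \<le> A_coef l n"
  using norm_add_norm_diff_mono[of "real n" 1 "exp (- \<i> * of_real l)"]
  by (simp add: A_coef_def scaleR_conv_of_real)

text \<open>The squares of the two moduli differ by \<open>4 * Re u\<close>.\<close>

lemma cmod_1_minus_less_cmod_1_plus: "Re u > 0 \<Longrightarrow> cmod (1 - u) < cmod (1 + u)"
  by (simp add: cmod_def power2_eq_square algebra_simps)

lemma B_coef_pos:
  assumes "l \<in> {- pi / 2 <..< pi / 2}"
  shows "B_coef l > 0"
proof -
  have "Re (exp (- \<i> * of_real l)) > 0"
    using assms cos_gt_zero_pi[of l] by (simp add: Re_exp)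
  then show ?thesis
    using cmod_1_minus_less_cmod_1_plus unfolding B_coef_def by simp
qed

lemma B_coef_le_A_coef: "B_coef l \<le> A_coef l 1"
  by (simp add: B_coef_def A_coef_def)

text \<open>Each term contains a factor \<open>z\<close> because \<open>m \<ge> 1\<close>, and the
  remaining powers have modulus at most 1. The offset \<open>m\<close> serves both series: 2 for
  \<open>h z - z\<close> and 1 for \<open>g z\<close>.\<close>

lemma power_series_tail_bound:
  fixes a :: "nat \<Rightarrow> complex"
  assumes "(\<lambda>n. a (n + m) * z ^ (n + m)) sums s" "m \<ge> 1" "cmod z \<le> 1"
    and "summable (\<lambda>n. cmod (a (n + m)))"
  shows "cmod s \<le> (\<Sum>n. cmod (a (n + m))) * cmod z"
proof (rule norm_sums_le[OF assms(1)])
  show "(\<lambda>n. cmod (a (n + m)) * cmod z) sums ((\<Sum>n. cmod (a (n + m))) * cmod z)"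
    using assms(4) by (intro sums_mult2 summable_sums)
  fix n
  have "cmod z ^ (n + m) \<le> cmod z ^ 1"
    using assms by (intro power_decreasing) auto
  then show "norm (a (n + m) * z ^ (n + m)) \<le> cmod (a (n + m)) * cmod z"
    by (simp add: norm_mult norm_power mult_left_mono)
qed

text \<open>Multiplying a weight by \<open>B_coef l / A_coef l 1\<close> cancels
  \<open>B_coef l\<close> and leaves \<open>A_coef l (n + m) / A_coef l 1\<close>, which is at least
  1 by \<open>A_coef_mono\<close>. Both claims then follow by comparison.\<close>

lemma weighted_summable_bound:
  fixes a :: "nat \<Rightarrow> complex"
  assumes "m \<ge> 1" "B_coef l > 0"
    and "summable (\<lambda>n. A_coef l (n + m) / B_coef l * cmod (a (n + m)))"
  shows "summable (\<lambda>n. cmod (a (n + m)))"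
    and "(\<Sum>n. cmod (a (n + m))) \<le>
           B_coef l / A_coef l 1 * (\<Sum>n. A_coef l (n + m) / B_coef l * cmod (a (n + m)))"
proof -
  let ?k = "B_coef l / A_coef l 1"
  let ?w = "\<lambda>n. A_coef l (n + m) / B_coef l * cmod (a (n + m))"
  have pos: "A_coef l 1 > 0" using assms B_coef_le_A_coef[of l] by simp
  have le: "cmod (a (n + m)) \<le> ?k * ?w n" for n
  proof -
    have "1 \<le> A_coef l (n + m) / A_coef l 1"
      using A_coef_mono[of "n + m" l] assms pos by simp
    then have "1 * cmod (a (n + m)) \<le> A_coef l (n + m) / A_coef l 1 * cmod (a (n + m))"
      by (intro mult_right_mono) auto
    then show ?thesis using assms by simp
  qed
  have sw: "summable (\<lambda>n. ?k * ?w n)" using assms(3) by (rule summable_mult)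
  show sa: "summable (\<lambda>n. cmod (a (n + m)))"
    by (rule summable_comparison_test'[OF sw, of 0]) (use le in auto)
  show "(\<Sum>n. cmod (a (n + m))) \<le> ?k * (\<Sum>n. ?w n)"
    using suminf_le[OF le sa sw] suminf_mult[OF assms(3), of ?k] by simp
qed

text \<open>Conjugation preserves the modulus, so the tails of \<open>h\<close> and \<open>g\<close>
  can be estimated separately; the two weighted sums are then recombined to apply the coefficient
  condition once.\<close>

lemma harmonic_class_dist_id_le:
  assumes "B_coef l > 0" "harmonic_class f h g a b" "coef_condition l a b" "z \<in> unit_disc"
  shows "cmod (f z - z) \<le> B_coef l / A_coef l 1 * cmod z"
proof -
  let ?k = "B_coef l / A_coef l 1"
  let ?S = "\<lambda>m a. \<Sum>n. A_coef l (n + m) / B_coef l * cmod (a (n + m))"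
  have k: "?k \<ge> 0" using assms(1) B_coef_le_A_coef[of l] by simp
  have a: "summable (\<lambda>n. A_coef l (n + 2) / B_coef l * cmod (a (n + 2)))"
    and b: "summable (\<lambda>n. A_coef l (n + 1) / B_coef l * cmod (b (n + 1)))"
    and S: "?S 2 a + ?S 1 b \<le> 1"
    using assms(3) unfolding coef_condition_def by blast+
  have z: "cmod z \<le> 1" using assms(4) by simp
  have sums: "(\<lambda>n. a (n + 2) * z ^ (n + 2)) sums (h z - z)"
      "(\<lambda>n. b (n + 1) * z ^ (n + 1)) sums g z" and f: "f z = h z + cnj (g z)"
    using assms(2,4) unfolding harmonic_class_def by blast+
  note wa = weighted_summable_bound[OF _ assms(1) a] and wb = weighted_summable_bound[OF _ assms(1) b]
  have "cmod (f z - z) \<le> cmod (h z - z) + cmod (g z)"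
    using norm_triangle_ineq[of "h z - z" "cnj (g z)"] by (simp add: f algebra_simps)
  also have "\<dots> \<le> (\<Sum>n. cmod (a (n + 2))) * cmod z + (\<Sum>n. cmod (b (n + 1))) * cmod z"
    using z wa(1) wb(1) by (intro add_mono power_series_tail_bound sums) auto
  also have "\<dots> \<le> (?k * ?S 2 a) * cmod z + (?k * ?S 1 b) * cmod z"
    using wa(2) wb(2) by (intro add_mono mult_right_mono) auto
  also have "\<dots> = ?k * (?S 2 a + ?S 1 b) * cmod z"
    by (simp only: distrib_left distrib_right)
  also have "\<dots> \<le> ?k * 1 * cmod z"
    using S k by (intro mult_right_mono mult_left_mono) auto
  finally show ?thesis by simp
qed

lemma near_identity_covers_ball:
  fixes f :: "'a::euclidean_space \<Rightarrow> 'a" and k :: real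
  assumes "continuous_on (ball 0 1) f"
    and "\<And>z. z \<in> ball 0 1 \<Longrightarrow> norm (f z - z) \<le> k * norm z" and "0 \<le> k"
  shows "ball 0 (1 - k) \<subseteq> f ` ball 0 1"
proof
  fix w :: 'a assume "w \<in> ball 0 (1 - k)"
  then have w: "norm w < 1 - k" by simp
  \<comment> \<open>For \<open>k \<ge> 1\<close> the ball to be covered is empty, so a point
    \<open>w\<close> in it forces \<open>k < 1\<close>.\<close>
  then have k1: "1 - k > 0" using norm_ge_zero[of w] by linarith
  \<comment> \<open>This radius solves \<open>norm w + k * r = r\<close>, which is what makes the
    closed ball invariant. For \<open>w = 0\<close> it degenerates to one point, which Brouwer's
    theorem still allows.\<close>
  define r where "r = norm w / (1 - k)"
  have r: "0 \<le> r" "r < 1" "norm w = (1 - k) * r"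
    using w k1 by (auto simp: r_def field_simps)
  have sub: "cball 0 r \<subseteq> (ball 0 1 :: 'a set)" using r by auto
  have self: "w - (f z - z) \<in> cball 0 r" if "z \<in> cball 0 r" for z
  proof -
    have "norm (w - (f z - z)) \<le> norm w + k * norm z"
      using norm_triangle_ineq4[of w "f z - z"] assms(2)[of z] that sub by fastforce
    also have "\<dots> \<le> (1 - k) * r + k * r"
      using r that assms(3) by (intro add_mono mult_left_mono) auto
    finally show ?thesis by (simp add: algebra_simps)
  qed
  obtain z where z: "z \<in> cball 0 r" "w - (f z - z) = z"
  proof (rule brouwer[of "cball 0 r" "\<lambda>z. w - (f z - z)"])
    show "continuous_on (cball 0 r) (\<lambda>z. w - (f z - z))"
      by (intro continuous_intros continuous_on_subset[OF assms(1) sub])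
  qed (use r self in auto)
  then have "w = f z" by (simp add: algebra_simps)
  then show "w \<in> f ` ball 0 1" using z sub by blast
qed

lemma harmonic_class_continuous_on:
  assumes "harmonic_class f h g a b"
  shows "continuous_on unit_disc f"
proof -
  have "continuous_on unit_disc (\<lambda>z. h z + cnj (g z))"
    using assms unfolding harmonic_class_def
    by (intro continuous_intros holomorphic_on_imp_continuous_on) auto
  then show ?thesis
    using assms unfolding harmonic_class_def
    by (subst continuous_on_cong[OF refl, of _ f "\<lambda>z. h z + cnj (g z)"]) auto
qed

text \<open>The only nonzero coefficient used is the one of index 1 in \<open>g\<close>, equal to
  \<open>t\<close>. The Jacobian is the constant \<open>1 - t\<^sup>2\<close>, and the coefficient
  sum is \<open>t * A_coef l 1 / B_coef l\<close>.\<close>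

lemma extremal_in_class:
  fixes t :: real
  assumes "B_coef l > 0" "0 \<le> t" "t < B_coef l / A_coef l 1"
  shows "harmonic_class (\<lambda>z. z + t * cnj z) (\<lambda>z. z) (\<lambda>z. t * z)
      (\<lambda>_. 0) (\<lambda>n. of_real (if n = 1 then t else 0))"
    and "coef_condition l (\<lambda>_. 0) (\<lambda>n. of_real (if n = 1 then t else 0))"
proof -
  have A: "A_coef l 1 > 0" using assms(1) B_coef_le_A_coef[of l] by simp
  have "B_coef l / A_coef l 1 \<le> 1" using A B_coef_le_A_coef[of l] by simp
  then have t1: "t < 1" using assms by linarith
  have "deriv (\<lambda>z. complex_of_real t * z) z = t" for z
    by (rule DERIV_imp_deriv) (auto intro!: derivative_eq_intros)
  then have "jacobian (\<lambda>z. z) (\<lambda>z. t * z) z > 0" for z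
    using assms(2) t1 by (simp add: jacobian_def abs_square_less_1)
  moreover have "(\<lambda>n. complex_of_real (if n + 1 = 1 then t else 0) * z ^ (n + 1)) sums (t * z)"
    for z :: complex
    using sums_finite[of "{0}" "\<lambda>n. complex_of_real (if n + 1 = 1 then t else 0) * z ^ (n + 1)"] by simp
  ultimately show "harmonic_class (\<lambda>z. z + t * cnj z) (\<lambda>z. z) (\<lambda>z. t * z)
      (\<lambda>_. 0) (\<lambda>n. of_real (if n = 1 then t else 0))"
    unfolding harmonic_class_def by (auto intro!: holomorphic_intros)
  let ?w = "\<lambda>n. A_coef l (n + 1) / B_coef l * cmod (complex_of_real (if n + 1 = 1 then t else 0))"
  have w: "?w sums (A_coef l 1 / B_coef l * t)"
    using sums_finite[of "{0}" ?w] assms(2) by simp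
  have "A_coef l 1 / B_coef l * t \<le> 1"
    using assms A by (simp add: field_simps)
  then have "summable ?w" "(\<Sum>n. ?w n) \<le> 1"
    using sums_summable[OF w] sums_unique[OF w] by (simp_all only:)
  then show "coef_condition l (\<lambda>_. 0) (\<lambda>n. of_real (if n = 1 then t else 0))"
    unfolding coef_condition_def by (simp only: norm_zero mult_zero_right suminf_zero
        summable_zero add_0 simp_thms)
qed

theorem theorem2p4:
  fixes l :: real
  assumes "l \<in> {- pi / 2 <..< pi / 2}"
  shows "(\<forall>f h g a b. harmonic_class f h g a b \<and> coef_condition l a b \<longrightarrow>
            (\<forall>z\<in>unit_disc.
               (1 - B_coef l / A_coef l 1) * cmod z \<le> cmod (f z) \<and>
               cmod (f z) \<le> (1 + B_coef l / A_coef l 1) * cmod z) \<and>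
            {w. cmod w < 1 - B_coef l / A_coef l 1} \<subseteq> f ` unit_disc) \<and>
         (\<forall>c::real. (\<forall>f h g a b. harmonic_class f h g a b \<and> coef_condition l a b \<longrightarrow>
                      (\<forall>z\<in>unit_disc. c * cmod z \<le> cmod (f z))) \<longrightarrow>
                  c \<le> 1 - B_coef l / A_coef l 1) \<and>
         (\<forall>c::real. (\<forall>f h g a b. harmonic_class f h g a b \<and> coef_condition l a b \<longrightarrow>
                      (\<forall>z\<in>unit_disc. cmod (f z) \<le> c * cmod z)) \<longrightarrow>
                  1 + B_coef l / A_coef l 1 \<le> c)"
proof -
  define k where "k = B_coef l / A_coef l 1"
  note B = B_coef_pos[OF assms]
  have k: "0 < k" "k \<le> 1"
    using B B_coef_le_A_coef[of l] by (simp_all add: k_def)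
  note extremal = extremal_in_class[OF B, folded k_def]
  have est: "cmod (f z - z) \<le> k * cmod z"
    if "harmonic_class f h g a b \<and> coef_condition l a b" "z \<in> unit_disc" for f h g a b z
    using harmonic_class_dist_id_le[OF B, folded k_def] that by blast
  have "(1 - k) * cmod z \<le> cmod (f z) \<and> cmod (f z) \<le> (1 + k) * cmod z"
    if "harmonic_class f h g a b \<and> coef_condition l a b" "z \<in> unit_disc" for f h g a b z
    \<comment> \<open>Both bounds come from the reverse triangle inequality for \<open>f z\<close>
      and \<open>z\<close>.\<close>
    using est[OF that] norm_triangle_ineq3[of "f z" z] by (simp add: algebra_simps abs_le_iff)
  moreover have "{w. cmod w < 1 - k} \<subseteq> f ` unit_disc"
    if "harmonic_class f h g a b \<and> coef_condition l a b" for f h g a b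
  proof -
    have "ball 0 (1 - k) \<subseteq> f ` unit_disc"
      using that k by (intro near_identity_covers_ball harmonic_class_continuous_on est[OF that]) auto
    then show ?thesis by (simp add: ball_def)
  qed
  moreover have "c \<le> 1 - k"
    if c: "\<forall>f h g a b. harmonic_class f h g a b \<and> coef_condition l a b \<longrightarrow>
        (\<forall>z\<in>unit_disc. c * cmod z \<le> cmod (f z))" for c :: real
  proof -
    have "t \<le> 1 - c" if "0 < t" "t < k" for t
    proof -
      have "\<forall>z\<in>unit_disc. c * cmod z \<le> cmod (z + t * cnj z)"
        using c[rule_format, OF conjI[OF extremal[OF less_imp_le[OF that(1)] that(2)]]] by blast
      \<comment> \<open>On the imaginary axis conjugation changes the sign, so the modulus shrinks
        by the factor \<open>1 - t\<close>.\<close>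
      then have "c * cmod (\<i> / 2) \<le> cmod (\<i> / 2 + t * cnj (\<i> / 2))"
        by (rule bspec) (simp add: norm_divide)
      also have "\<i> / 2 + t * cnj (\<i> / 2) = of_real ((1 - t) / 2) * \<i>"
        by (simp add: field_simps)
      also have "cmod \<dots> = (1 - t) / 2"
        using that k by (simp only: norm_mult norm_of_real) simp
      finally show ?thesis by (simp add: norm_divide)
    qed
    \<comment> \<open>The bound holds for all \<open>t\<close> in the nonempty open interval from 0
      to \<open>k\<close>, hence also for its supremum \<open>k\<close>.\<close>
    then have "k \<le> 1 - c" by (intro dense_le_bounded[OF k(1)])
    then show ?thesis by simp
  qed
  moreover have "1 + k \<le> c"
    if c: "\<forall>f h g a b. harmonic_class f h g a b \<and> coef_condition l a b \<longrightarrow>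
        (\<forall>z\<in>unit_disc. cmod (f z) \<le> c * cmod z)" for c :: real
  proof -
    have "t \<le> c - 1" if "0 < t" "t < k" for t
    proof -
      have "\<forall>z\<in>unit_disc. cmod (z + t * cnj z) \<le> c * cmod z"
        using c[rule_format, OF conjI[OF extremal[OF less_imp_le[OF that(1)] that(2)]]] by blast
      \<comment> \<open>Conjugation fixes real points, so here the modulus grows by the factor
        \<open>1 + t\<close>.\<close>
      then have "cmod (1 / 2 + t * cnj (1 / 2)) \<le> c * cmod (1 / 2)"
        by (rule bspec) (simp add: norm_divide)
      moreover have "1 / 2 + t * cnj (1 / 2) = complex_of_real ((1 + t) / 2)"
        by (simp add: field_simps)
      ultimately show ?thesis using that(1) by (simp only: norm_of_real) (simp add: norm_divide)
    qed
    then have "k \<le> c - 1" by (intro dense_le_bounded[OF k(1)])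
    then show ?thesis by simp
  qed
  ultimately show ?thesis unfolding k_def[symmetric] by blast
qed

end
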